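(* Let $n\geq1$ and let $g$ be a measurable function on $\mathbb{R}^n$. Denote by $T_g$ the multiplier operator $T_g(f)=fg$. Then $T_g$ is a bounded operator in $BMO_H(\mathbb{R}^n)$ if and only if (i) $g\in L^\infty(\mathbb{R}^n)$; and (ii) there exists $C>0$ such that $$\log\left(\frac{\gamma(x)}{s}\right)\frac{1}{|B(x,s)|}\int_{B(x,s)}|g(y)-g_{B(x,s)}|\,dy\leq C$$ for every $x\in\mathbb{R}^n$ and every ball $B(x,s)$ with radius $0<s\leq\gamma(x)$.
   Context: $B(x,r)$ is the ball in $\mathbb{R}^n$ with center $x$ and radius $r$; for a ball $B$, $f_B=\frac{1}{|B|}\int_Bf(x)\,dx$. The critical radii function is $\gamma(x)=\frac{1}{1+|x|}$ if $|x|\geq1$ and $\gamma(x)=\frac12$ if $|x|<1$. A locally integrable $f$ on $\mathbb{R}^n$ belongs to $BMO_H(\mathbb{R}^n)$ if there exists $C>0$ such that (a) $\frac{1}{|B|}\int_B|f(x)-f_B|\,dx\leq C$ for every ball $B$, and (b) $\frac{1}{|B|}\int_B|f(x)|\,dx\leq C$ for every ball $B=B(x_0,r_0)$ with $x_0\in\mathbb{R}^n$, $r_0\geq\gamma(x_0)$. The norm $\|f\|_{BMO_H(\mathbb{R}^n)}$ is the infimum of the $C\geq0$ such that (a) and (b) hold. "$T_g$ is a bounded operator in $BMO_H(\mathbb{R}^n)$" means that there is a constant $A$ such that $fg\in BMO_H(\mathbb{R}^n)$ and $\|fg\|_{BMO_H(\mathbb{R}^n)}\leq A\|f\|_{BMO_H(\mathbb{R}^n)}$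 for all $f\in BMO_H(\mathbb{R}^n)$. *)

theory Defs
  imports "HOL-Analysis.Analysis"
begin

text \<open>
  Functions on \<open>\<real>\<^sup>n\<close> take scalar values in a complete, second countable normed field over the reals
  (with multiplicative norm). By Gelfand--Mazur such a field is isometrically the reals or the
  complex numbers, so the definitions cover exactly the real-valued and the complex-valued
  function spaces.
\<close>

definition critical_radius :: "real ^ 'n \<Rightarrow> real" where
  "critical_radius x = (if norm x \<ge> 1 then 1 / (1 + norm x) else 1 / 2)"

definition locally_integrable ::
    "(real ^ 'n \<Rightarrow> 'b::{real_normed_field,banach,second_countable_topology}) \<Rightarrow> bool" where
  "locally_integrable f \<longleftrightarrow> (\<forall>K. compact K \<longrightarrow> f absolutely_integrable_on K)"

text \<open>The mean of \<open>f\<close> over \<open>B\<close>; it is \<open>0\<close> by convention if \<open>f\<close> is not integrable on \<open>B\<close>.\<close>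

definition mean_on ::
    "(real ^ 'n) set \<Rightarrow> (real ^ 'n \<Rightarrow> 'b::{banach,second_countable_topology}) \<Rightarrow> 'b" where
  "mean_on B f = (1 / measure lebesgue B) *\<^sub>R (LINT y:B|lebesgue. f y)"

definition mean_oscillation ::
    "(real ^ 'n) set \<Rightarrow> (real ^ 'n \<Rightarrow> 'b::{banach,second_countable_topology}) \<Rightarrow> real" where
  "mean_oscillation B f = mean_on B (\<lambda>y. norm (f y - mean_on B f))"

definition BMO_H_bound ::
    "(real ^ 'n \<Rightarrow> 'b::{real_normed_field,banach,second_countable_topology}) \<Rightarrow> real \<Rightarrow> bool" where
  "BMO_H_bound f C \<longleftrightarrow>
     (\<forall>x r. r > 0 \<longrightarrow> mean_oscillation (ball x r) f \<le> C) \<and>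
     (\<forall>x r. r \<ge> critical_radius x \<longrightarrow> mean_on (ball x r) (\<lambda>y. norm (f y)) \<le> C)"

definition BMO_H ::
    "(real ^ 'n \<Rightarrow> 'b::{real_normed_field,banach,second_countable_topology}) set" where
  "BMO_H = {f. locally_integrable f \<and> (\<exists>C>0. BMO_H_bound f C)}"

definition BMO_H_norm ::
    "(real ^ 'n \<Rightarrow> 'b::{real_normed_field,banach,second_countable_topology}) \<Rightarrow> real" where
  "BMO_H_norm f = Inf {C. C \<ge> 0 \<and> BMO_H_bound f C}"

definition multiplier_op ::
    "(real ^ 'n \<Rightarrow> 'b::{real_normed_field,banach,second_countable_topology}) \<Rightarrow>
     (real ^ 'n \<Rightarrow> 'b) \<Rightarrow> real ^ 'n \<Rightarrow> 'b" where
  "multiplier_op g f = (\<lambda>x. f x * g x)"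

text \<open>Linearity is not part of this predicate; multiplier operators are linear.\<close>

definition bounded_operator_in_BMO_H ::
    "((real ^ 'n \<Rightarrow> 'b::{real_normed_field,banach,second_countable_topology}) \<Rightarrow>
      real ^ 'n \<Rightarrow> 'b) \<Rightarrow> bool" where
  "bounded_operator_in_BMO_H T \<longleftrightarrow>
     (\<exists>A. \<forall>f\<in>BMO_H. T f \<in> BMO_H \<and> BMO_H_norm (T f) \<le> A * BMO_H_norm f)"

definition L_infinity ::
    "(real ^ 'n \<Rightarrow> 'b::{real_normed_field,banach,second_countable_topology}) set" where
  "L_infinity = {g \<in> borel_measurable lebesgue. \<exists>M. AE x in lebesgue. norm (g x) \<le> M}"

end

theory Submission
  imports Defs
begin

text \<open>
  Write \<open>\<gamma>\<close> for the critical radius and \<open>n\<close> for the dimension. A function \<open>f\<close> of norm \<open>1\<close> in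
  \<open>BMO\<^sub>H\<close> has a mean of size at most \<open>1\<close> over every ball that reaches the critical radius, and
  halving a radius changes the mean by at most \<open>2\<^sup>n\<close>. Hence the mean of \<open>f\<close> over \<open>B(x,s)\<close> can
  grow no faster than \<open>1 + log (\<gamma>(x)/s)\<close> as \<open>s\<close> shrinks (lemma \<open>norm_mean_on_ball_le\<close>).
  The theorem expresses that this rate of growth is sharp.

  \<^emph>\<open>Sufficiency.\<close> On a ball \<open>B\<close> of subcritical radius split
  \<open>f g - f\<^sub>B g\<^sub>B = (f - f\<^sub>B) g + f\<^sub>B (g - g\<^sub>B)\<close>. The mean of the first term is controlled by the bound
  on \<open>g\<close> and the oscillation of \<open>f\<close>, that of the second one by \<open>\<bar>f\<^sub>B\<bar>\<close>, which is at most
  logarithmic, times the oscillation of \<open>g\<close>, which compensates the logarithm. On a larger ball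
  only the bound on \<open>g\<close> matters, because there the means of \<open>\<bar>f\<bar>\<close> are bounded.

  \<^emph>\<open>Necessity.\<close> The growth rate is attained by a truncation of the logarithm
  \<open>log (\<gamma>(x)/\<bar>z - x\<bar>)\<close>, made constant on a small ball around \<open>x\<close>. The discrete version used here
  counts how many of the concentric balls of radii \<open>\<gamma>(x)/2\<^sup>k\<close>, \<open>k \<le> m\<close>, contain \<open>z\<close>; it
  takes the value \<open>m + 1\<close> on the smallest of them, while its norm is bounded independently of \<open>x\<close>
  and \<open>m\<close> (lemma \<open>BMO_H_bound_dyadic_staircase\<close>). Multiplying it by \<open>g\<close> gives a function of
  bounded norm which on the smallest ball equals \<open>(m + 1) g\<close>. Reading off its oscillation on
  the balls inside it yields condition (ii). By the growth estimate its mean on that ball, and hence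
  the mean of its absolute value, is at most of order \<open>m + 1\<close>, so the factor cancels and the means
  of \<open>\<bar>g\<bar>\<close> over small balls are bounded; by Lebesgue differentiation \<open>g\<close> is essentially bounded, which is condition (i).
\<close>

section \<open>Means and mean oscillations\<close>

lemma mean_on_cong:
  assumes "B \<in> lmeasurable" "\<And>y. y \<in> B \<Longrightarrow> f y = g y"
  shows "mean_on B f = mean_on B g"
proof -
  have "(LINT y:B|lebesgue. f y) = (LINT y:B|lebesgue. g y)"
    using assms by (intro set_lebesgue_integral_cong) (auto simp: fmeasurableD)
  then show ?thesis
    by (simp add: mean_on_def)
qed

lemma set_integrable_const_lmeasurable:
  fixes c :: "'b::{banach,second_countable_topology}"
  assumes "B \<in> lmeasurable"
  shows "set_integrable lebesgue B (\<lambda>_. c)"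
  using assms unfolding set_integrable_def fmeasurable_def
  by (intro integrable_scaleR_left integrable_real_indicator) auto

lemma mean_on_const:
  assumes "B \<in> lmeasurable" "0 < measure lebesgue B"
  shows "mean_on B (\<lambda>_. c) = c"
proof -
  have "(LINT y:B|lebesgue. c) = measure lebesgue B *\<^sub>R c"
    using assms(1) by (intro set_integral_const) (auto simp: fmeasurable_def)
  then show ?thesis
    using assms(2) by (simp add: mean_on_def)
qed

lemma mean_on_add:
  assumes "set_integrable lebesgue B f" "set_integrable lebesgue B g"
  shows "mean_on B (\<lambda>y. f y + g y) = mean_on B f + mean_on B g"
  using assms by (simp add: mean_on_def scaleR_add_right)

lemma mean_on_diff_const:
  assumes "B \<in> lmeasurable" "0 < measure lebesgue B" "set_integrable lebesgue B f"
  shows "mean_on B (\<lambda>y. f y - c) = mean_on B f - c"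
  using assms mean_on_const[OF assms(1,2), of c]
  by (simp add: mean_on_def set_integrable_const_lmeasurable scaleR_diff_right)

lemma mean_on_mult_left:
  fixes f :: "real ^ 'n \<Rightarrow> 'b::{real_normed_field,banach,second_countable_topology}"
  shows "mean_on B (\<lambda>y. c * f y) = c * mean_on B f"
  by (simp add: mean_on_def)

lemma mean_on_mono:
  fixes f g :: "real ^ 'n \<Rightarrow> real"
  assumes "set_integrable lebesgue B f" "set_integrable lebesgue B g"
    "\<And>y. y \<in> B \<Longrightarrow> f y \<le> g y"
  shows "mean_on B f \<le> mean_on B g"
  unfolding mean_on_def using set_integral_mono[OF assms] by (simp add: divide_right_mono)

lemma mean_on_mono_AE:
  fixes f g :: "real ^ 'n \<Rightarrow> real"
  assumes "set_integrable lebesgue B f" "set_integrable lebesgue B g"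
    "AE y in lebesgue. f y \<le> g y"
  shows "mean_on B f \<le> mean_on B g"
proof -
  have "(LINT y:B|lebesgue. f y) \<le> (LINT y:B|lebesgue. g y)"
    using assms by (intro set_integral_mono_AE) auto
  then show ?thesis
    by (simp add: mean_on_def divide_right_mono)
qed

lemma norm_mean_on_le:
  assumes "set_integrable lebesgue B f"
  shows "norm (mean_on B f) \<le> mean_on B (\<lambda>y. norm (f y))"
  unfolding mean_on_def using set_integral_norm_bound[OF assms]
  by (simp add: divide_right_mono)

lemma mean_on_subset_le:
  fixes f :: "real ^ 'n \<Rightarrow> real"
  assumes "A \<subseteq> B" "A \<in> lmeasurable" "0 < measure lebesgue A" "0 < measure lebesgue B"
    and "set_integrable lebesgue B f" "\<And>y. 0 \<le> f y"
  shows "mean_on A f \<le> measure lebesgue B / measure lebesgue A * mean_on B f"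
proof -
  have A: "A \<in> sets lebesgue" using assms(2) by (simp add: fmeasurableD)
  have int: "set_integrable lebesgue A f"
    using set_integrable_subset[OF assms(5) A assms(1)] .
  have "(LINT y:A|lebesgue. f y) \<le> (LINT y:B|lebesgue. f y)"
    using int assms unfolding set_integrable_def set_lebesgue_integral_def
    by (intro integral_mono) (auto simp: indicator_def)
  then show ?thesis
    using assms(3,4) by (simp add: mean_on_def divide_right_mono)
qed

lemma set_integrable_norm_diff_const:
  fixes f :: "real ^ 'n \<Rightarrow> 'b::{banach,second_countable_topology}"
  assumes "B \<in> lmeasurable" "set_integrable lebesgue B f"
  shows "set_integrable lebesgue B (\<lambda>y. norm (f y - c))"
  using assms by (intro set_integrable_norm set_integral_diff(1) set_integrable_const_lmeasurable)

lemma norm_mean_on_diff_le: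
  assumes "B \<in> lmeasurable" "0 < measure lebesgue B" "set_integrable lebesgue B f"
  shows "norm (mean_on B f - c) \<le> mean_on B (\<lambda>y. norm (f y - c))"
  using norm_mean_on_le[of B "\<lambda>y. f y - c"] mean_on_diff_const[OF assms, of c] assms
  by (simp add: set_integrable_const_lmeasurable)

text \<open>The mean is within a factor two of the best constant, so that an oscillation may be
  estimated with any convenient constant in place of the mean.\<close>

lemma mean_oscillation_le:
  assumes "B \<in> lmeasurable" "0 < measure lebesgue B" "set_integrable lebesgue B f"
  shows "mean_oscillation B f \<le> 2 * mean_on B (\<lambda>y. norm (f y - c))"
proof -
  let ?m = "mean_on B f"
  note int = set_integrable_norm_diff_const[OF assms(1,3)]
  note const = set_integrable_const_lmeasurable[OF assms(1)]
  have "mean_oscillation B f \<le> mean_on B (\<lambda>y. norm (f y - c) + norm (?m - c))"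
    unfolding mean_oscillation_def
  proof (rule mean_on_mono[OF int set_integral_add(1)[OF int const]])
    show "norm (f y - ?m) \<le> norm (f y - c) + norm (?m - c)" for y
      using norm_triangle_ineq4[of "f y - c" "?m - c"] by simp
  qed
  also have "\<dots> = mean_on B (\<lambda>y. norm (f y - c)) + norm (?m - c)"
    by (simp add: mean_on_add[OF int const] mean_on_const[OF assms(1,2)])
  also have "\<dots> \<le> 2 * mean_on B (\<lambda>y. norm (f y - c))"
    using norm_mean_on_diff_le[OF assms, of c] by simp
  finally show ?thesis .
qed

lemma mean_norm_le_oscillation:
  assumes "B \<in> lmeasurable" "0 < measure lebesgue B" "set_integrable lebesgue B f"
  shows "mean_on B (\<lambda>y. norm (f y)) \<le> mean_oscillation B f + norm (mean_on B f)"
proof -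
  let ?m = "mean_on B f"
  note int = set_integrable_norm_diff_const[OF assms(1,3), of ?m]
  note const = set_integrable_const_lmeasurable[OF assms(1)]
  have "mean_on B (\<lambda>y. norm (f y)) \<le> mean_on B (\<lambda>y. norm (f y - ?m) + norm ?m)"
  proof (rule mean_on_mono[OF set_integrable_norm[OF assms(3)] set_integral_add(1)[OF int const]])
    show "norm (f y) \<le> norm (f y - ?m) + norm ?m" for y
      using norm_triangle_ineq[of "f y - ?m" ?m] by simp
  qed
  also have "\<dots> = mean_oscillation B f + norm ?m"
    by (simp add: mean_on_add[OF int const] mean_on_const[OF assms(1,2)] mean_oscillation_def)
  finally show ?thesis .
qed

lemma mean_oscillation_mult_left:
  fixes f :: "real ^ 'n \<Rightarrow> 'b::{real_normed_field,banach,second_countable_topology}"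
  shows "mean_oscillation B (\<lambda>y. c * f y) = norm c * mean_oscillation B f"
proof -
  have "norm (c * f y - mean_on B (\<lambda>y. c * f y)) = norm c * norm (f y - mean_on B f)" for y
    unfolding mean_on_mult_left by (metis norm_mult right_diff_distrib)
  then show ?thesis
    by (simp add: mean_oscillation_def mean_on_mult_left)
qed

lemma mean_oscillation_cong:
  assumes "B \<in> lmeasurable" "\<And>y. y \<in> B \<Longrightarrow> f y = g y"
  shows "mean_oscillation B f = mean_oscillation B g"
  using assms mean_on_cong[OF assms] unfolding mean_oscillation_def
  by (intro mean_on_cong) auto

lemma mean_on_nonneg:
  fixes f :: "real ^ 'n \<Rightarrow> real"
  assumes "\<And>y. 0 \<le> f y"
  shows "0 \<le> mean_on B f"
  using assms by (simp add: mean_on_def set_lebesgue_integral_def integral_nonneg)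

lemma mean_oscillation_nonneg: "0 \<le> mean_oscillation B f"
  by (simp add: mean_oscillation_def mean_on_nonneg)

section \<open>Integrals and volumes of balls\<close>

lemma measure_ball_pos: "0 < r \<Longrightarrow> 0 < measure lebesgue (ball (x :: real ^ 'n) r)"
  by simp

lemma measure_ball:
  "0 \<le> r \<Longrightarrow> measure lebesgue (ball (x :: real ^ 'n) r)
    = unit_ball_vol (real CARD('n)) * r ^ CARD('n)"
  using content_ball[of r x] by simp

lemma measure_ball_double:
  "0 \<le> r \<Longrightarrow> measure lebesgue (ball (x :: real ^ 'n) (2 * r))
     = 2 ^ CARD('n) * measure lebesgue (ball x r)"
  using measure_ball[of "2 * r" x] measure_ball[of r x] by (simp add: power_mult_distrib)

lemma locally_integrable_ball:
  fixes f :: "real ^ 'n \<Rightarrow> 'b::{real_normed_field,banach,second_countable_topology}"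
  assumes "locally_integrable f"
  shows "set_integrable lebesgue (ball x r) f"
proof -
  have "set_integrable lebesgue (cball x r) f"
    using assms by (simp add: locally_integrable_def)
  then show ?thesis
    by (rule set_integrable_subset) auto
qed

section \<open>The critical radius and the norm\<close>

lemma critical_radius_eq: "critical_radius x = 1 / (1 + max 1 (norm x))"
  by (simp add: critical_radius_def max_def)

lemma critical_radius_pos: "0 < critical_radius x"
  by (simp add: critical_radius_eq add_pos_nonneg)

text \<open>This comparison makes the test functions centred at \<open>x\<close> small on average over every ball of
  supercritical radius, wherever its centre \<open>y\<close> lies.\<close>

lemma critical_radius_le_add_dist: "critical_radius x \<le> critical_radius y + dist x y"
proof -
  define a b where "a = max 1 (norm x)" and "b = max 1 (norm y)"
  have ab: "1 \<le> a" "1 \<le> b" by (auto simp: a_def b_def)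
  have "norm y \<le> norm x + dist x y"
    using norm_triangle_ineq2[of y x] by (simp add: dist_norm norm_minus_commute)
  then have "b - a \<le> dist x y"
    unfolding a_def b_def using zero_le_dist[of x y] by linarith
  moreover have "1 / (1 + a) - 1 / (1 + b) = (b - a) / ((1 + a) * (1 + b))"
    using ab by (simp add: field_simps)
  moreover have "(b - a) / ((1 + a) * (1 + b)) \<le> max 0 (b - a)"
  proof (cases "b \<le> a")
    case True
    then show ?thesis using ab by (simp add: divide_nonpos_pos)
  next
    case False
    have "1 * 1 \<le> (1 + a) * (1 + b)" using ab by (intro mult_mono) auto
    then have "(b - a) / ((1 + a) * (1 + b)) \<le> (b - a) / 1"
      using False by (intro divide_left_mono) auto
    then show ?thesis by simp
  qed
  ultimately show ?thesis
    by (simp add: critical_radius_eq a_def b_def) (smt (verit) zero_le_dist)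
qed

lemma BMO_H_bound_nonneg:
  assumes "BMO_H_bound f C"
  shows "0 \<le> C"
proof -
  have "mean_oscillation (ball 0 1) f \<le> C"
    using assms by (auto simp: BMO_H_bound_def)
  then show ?thesis
    using mean_oscillation_nonneg order_trans by blast
qed

text \<open>The infimum is attained, since both families of conditions are closed in the constant.\<close>

lemma BMO_H_bound_norm:
  assumes "f \<in> BMO_H"
  shows "BMO_H_bound f (BMO_H_norm f)"
proof -
  let ?S = "{C. C \<ge> 0 \<and> BMO_H_bound f C}"
  have "?S \<noteq> {}"
    using assms by (auto simp: BMO_H_def intro: less_imp_le)
  then show ?thesis
    unfolding BMO_H_norm_def BMO_H_bound_def[of f "Inf _"]
    by (intro conjI allI impI cInf_greatest) (auto simp: BMO_H_bound_def)
qed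

lemma BMO_H_norm_le:
  assumes "BMO_H_bound f C"
  shows "BMO_H_norm f \<le> C"
  unfolding BMO_H_norm_def
  using assms BMO_H_bound_nonneg by (intro cInf_lower bdd_belowI[of _ 0]) auto

lemma BMO_H_bound_mono: "BMO_H_bound f C \<Longrightarrow> C \<le> D \<Longrightarrow> BMO_H_bound f D"
  unfolding BMO_H_bound_def by (meson order_trans)

lemma BMO_H_I:
  assumes "locally_integrable f" "BMO_H_bound f C"
  shows "f \<in> BMO_H"
  using assms BMO_H_bound_mono[of f C "max C 1"] by (auto simp: BMO_H_def intro!: exI[of _ "max C 1"])

section \<open>Logarithmic growth of means over small balls\<close>

text \<open>Double the radius \<open>m\<close> times until the critical radius is reached. Each doubling multiplies the
  volume by \<open>2\<^sup>n\<close>, so the mean over the smaller ball differs from the mean over the larger one by at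
  most \<open>2\<^sup>n\<close> times the oscillation over the larger one.\<close>

lemma norm_mean_on_ball_le:
  fixes f :: "real ^ 'n \<Rightarrow> 'b::{real_normed_field,banach,second_countable_topology}"
  assumes f: "locally_integrable f" "BMO_H_bound f C"
    and s: "0 < s" "critical_radius x \<le> 2 ^ m * s"
  shows "norm (mean_on (ball x s) f) \<le> C * (1 + real m * 2 ^ CARD('n))"
  using s
proof (induction m arbitrary: s)
  case 0
  then have "mean_on (ball x s) (\<lambda>y. norm (f y)) \<le> C"
    using f(2) by (simp add: BMO_H_bound_def)
  then show ?case
    using norm_mean_on_le[OF locally_integrable_ball[OF f(1)], of x s] by simp
next
  case (Suc m)
  let ?A = "ball x s" and ?B = "ball x (2 * s)"
  let ?c = "mean_on ?B f"
  have "norm (mean_on ?A f - ?c) \<le> mean_on ?A (\<lambda>y. norm (f y - ?c))"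
    using Suc.prems(1) by (intro norm_mean_on_diff_le locally_integrable_ball[OF f(1)]) auto
  also have "\<dots> \<le> measure lebesgue ?B / measure lebesgue ?A * mean_on ?B (\<lambda>y. norm (f y - ?c))"
    using Suc.prems(1)
    by (intro mean_on_subset_le set_integrable_norm_diff_const locally_integrable_ball[OF f(1)])
      (auto simp: subset_ball)
  also have "\<dots> = 2 ^ CARD('n) * mean_oscillation ?B f"
    using measure_ball_double[of s x] measure_ball_pos[of s x] Suc.prems(1)
    by (simp add: mean_oscillation_def)
  also have "\<dots> \<le> 2 ^ CARD('n) * C"
    using f(2) Suc.prems(1) by (auto simp: BMO_H_bound_def)
  finally have "norm (mean_on ?A f) \<le> 2 ^ CARD('n) * C + norm ?c"
    using norm_triangle_ineq2[of "mean_on ?A f" ?c] by simp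
  moreover have "norm ?c \<le> C * (1 + real m * 2 ^ CARD('n))"
    using Suc.prems by (intro Suc.IH) (auto simp: mult_ac)
  ultimately show ?case
    by (simp add: algebra_simps)
qed

section \<open>The logarithmic test functions\<close>

text \<open>A step function version of \<open>log\<^sub>2 (\<rho> / dist x z)\<close>, truncated below at \<open>0\<close> and above at a height
  of order \<open>m\<close>. Its averages are finite sums of volumes of intersections of balls, so that no
  integral of a logarithm has to be computed.\<close>

definition dyadic_staircase :: "real ^ 'n \<Rightarrow> real \<Rightarrow> nat \<Rightarrow> real ^ 'n \<Rightarrow> real" where
  "dyadic_staircase x \<rho> m z = (\<Sum>k\<le>m. indicat_real (ball x (\<rho> / 2 ^ k)) z)"

text \<open>The terms form a geometric progression of ratio \<open>1/2\<close> whose largest member is at most \<open>R\<close>.\<close>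

lemma sum_dyadic_below_le:
  fixes \<rho> R :: real
  assumes "0 \<le> \<rho>" "0 \<le> R"
  shows "(\<Sum>k | k \<le> m \<and> \<rho> / 2 ^ k \<le> R. \<rho> / 2 ^ k) \<le> 2 * R"
proof -
  have "(\<Sum>k\<le>m. if \<rho> / 2 ^ k \<le> R then \<rho> / 2 ^ k else 0)
      \<le> (if \<rho> / 2 ^ m \<le> R then 2 * R - \<rho> / 2 ^ m else 0)"
    \<comment> \<open>Subtracting the last term on the right leaves room for the half-sized next one.\<close>
  proof (induction m)
    case (Suc m)
    define a where "a = \<rho> / 2 ^ m"
    have "0 \<le> a" "\<rho> / 2 ^ Suc m = a / 2" using assms by (auto simp: a_def)
    then show ?case using Suc assms unfolding a_def[symmetric] by (auto split: if_splits)
  qed auto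
  also have "\<dots> \<le> 2 * R"
    using assms by auto
  also have "(\<Sum>k\<le>m. if \<rho> / 2 ^ k \<le> R then \<rho> / 2 ^ k else 0)
      = (\<Sum>k | k \<le> m \<and> \<rho> / 2 ^ k \<le> R. \<rho> / 2 ^ k)"
    by (subst sum.inter_filter[symmetric]) auto
  finally show ?thesis .
qed

text \<open>Two different effects give the same bound. If \<open>x\<close> is far from \<open>y\<close> in comparison with \<open>r\<close>, the
  balls can meet only when \<open>t\<close> is comparable to \<open>dist x y + r\<close>, and then the right-hand side is at
  least the volume of \<open>ball y r\<close>. If \<open>x\<close> is near, the volume of \<open>ball x t\<close> alone is small
  enough; there the \<open>n\<close>-th power of the ratio is at most the ratio itself. A bound that is linear in
  \<open>t\<close> can then be summed over dyadic radii.\<close>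

lemma measure_ball_inter_le:
  fixes x y :: "real ^ 'n"
  assumes "0 < t" "0 < r" "t \<le> dist x y + r"
  shows "measure lebesgue (ball y r \<inter> ball x t)
    \<le> 3 ^ CARD('n) * (t / (dist x y + r)) * measure lebesgue (ball y r)"
proof -
  define q where "q = t / (dist x y + r)"
  have R: "0 < dist x y + r" using assms by (simp add: add_nonneg_pos)
  have q: "0 < q" "q \<le> 1" using assms R by (auto simp: q_def)
  have int: "ball y r \<inter> ball x t \<in> sets lebesgue" by simp
  consider "ball y r \<inter> ball x t = {}" | "ball y r \<inter> ball x t \<noteq> {}" "2 * r \<le> dist x y"
    | "dist x y < 2 * r" by linarith
  then show ?thesis
  proof cases
    case 1
    then show ?thesis using R assms by simp
  next
    case 2
    then obtain z where "dist y z < r" "dist x z < t" by auto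
    then have "dist x y < t + r"
      using dist_triangle[of x y z] by (simp add: dist_commute)
    then have "1 \<le> 3 * q"
      using 2 R by (simp add: q_def field_simps)
    also have "3 * q \<le> 3 ^ CARD('n) * q"
      using q power_increasing[of 1 "CARD('n)" "3::real"] by (simp add: Suc_leI)
    finally have "1 \<le> 3 ^ CARD('n) * q" .
    moreover have "measure lebesgue (ball y r \<inter> ball x t) \<le> 1 * measure lebesgue (ball y r)"
      using measure_mono_fmeasurable[OF Int_lower1 int] by simp
    ultimately show ?thesis
      unfolding q_def[symmetric] by (meson measure_nonneg mult_right_mono order_trans)
  next
    case 3
    have "t / r \<le> 3 * q"
      using 3 R assms by (simp add: q_def field_simps)
    then have "(t / r) ^ CARD('n) \<le> (3 * q) ^ CARD('n)"
      using assms by (intro power_mono) auto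
    also have "\<dots> \<le> 3 ^ CARD('n) * q"
      using q power_decreasing[of 1 "CARD('n)" q] by (simp add: power_mult_distrib Suc_leI)
    finally have le: "(t / r) ^ CARD('n) \<le> 3 ^ CARD('n) * q" .
    have "measure lebesgue (ball y r \<inter> ball x t) \<le> measure lebesgue (ball x t)"
      using measure_mono_fmeasurable[OF Int_lower2 int] by simp
    also have "\<dots> = (t / r) ^ CARD('n) * measure lebesgue (ball y r)"
      using assms measure_ball[of t x] measure_ball[of r y] by (simp add: power_divide)
    also have "\<dots> \<le> 3 ^ CARD('n) * q * measure lebesgue (ball y r)"
      using le by (intro mult_right_mono) auto
    finally show ?thesis by (simp add: q_def)
  qed
qed

lemma set_integrable_indicator:
  assumes "B \<in> lmeasurable" "A \<in> sets lebesgue"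
  shows "set_integrable lebesgue B (indicator A :: real ^ 'n \<Rightarrow> real)"
proof -
  have "(\<lambda>y. indicat_real B y *\<^sub>R indicat_real A y) = indicat_real (B \<inter> A)"
    by (auto simp: indicator_def)
  moreover have "integrable lebesgue (indicat_real (B \<inter> A))"
    using fmeasurable_Int_fmeasurable[OF assms] unfolding fmeasurable_def
    by (intro integrable_real_indicator) auto
  ultimately show ?thesis
    by (simp add: set_integrable_def)
qed

lemma mean_on_indicator:
  assumes "B \<in> lmeasurable" "A \<in> sets lebesgue"
  shows "mean_on B (indicator A :: real ^ 'n \<Rightarrow> real)
    = measure lebesgue (B \<inter> A) / measure lebesgue B"
proof -
  have "(\<lambda>y. indicat_real B y *\<^sub>R indicat_real A y) = indicat_real (B \<inter> A)"
    by (auto simp: indicator_def)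
  then show ?thesis
    by (simp add: mean_on_def set_lebesgue_integral_def)
qed

lemma set_integrable_sum_indicator_balls:
  fixes x :: "real ^ 'n"
  assumes "B \<in> lmeasurable" "finite S"
  shows "set_integrable lebesgue B (\<lambda>z. \<Sum>k\<in>S. indicator (ball x (t k)) z :: real)"
  using assms(2)
proof induction
  case empty
  then show ?case by (simp add: set_integrable_def)
next
  case (insert k S)
  then show ?case
    using set_integral_add(1)[OF set_integrable_indicator[OF assms(1)] insert.IH, of "ball x (t k)"]
    by simp
qed

lemma mean_on_sum_indicator_balls:
  fixes x :: "real ^ 'n"
  assumes "B \<in> lmeasurable" "finite S"
  shows "mean_on B (\<lambda>z. \<Sum>k\<in>S. indicator (ball x (t k)) z :: real)
    = (\<Sum>k\<in>S. measure lebesgue (B \<inter> ball x (t k)) / measure lebesgue B)"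
  using assms(2)
proof induction
  case empty
  then show ?case by (simp add: mean_on_def)
next
  case (insert k S)
  then show ?case
    using mean_on_add[OF set_integrable_indicator[OF assms(1)]
        set_integrable_sum_indicator_balls[OF assms(1) insert.hyps(1)], of "ball x (t k)" x t]
    by (simp add: mean_on_indicator assms(1))
qed

text \<open>This is the uniform estimate behind the norm bound of the test functions: the steps of radius at
  most \<open>dist x y + r\<close>, the only ones that can vary on \<open>ball y r\<close>, have a bounded total mean there,
  however many of them there are.\<close>

lemma mean_on_small_balls_le:
  fixes x y :: "real ^ 'n"
  assumes "0 < \<rho>" "0 < r"
  shows "mean_on (ball y r)
      (\<lambda>z. \<Sum>k | k \<le> m \<and> \<rho> / 2 ^ k \<le> dist x y + r. indicat_real (ball x (\<rho> / 2 ^ k)) z)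
    \<le> 2 * 3 ^ CARD('n)"
proof -
  let ?R = "dist x y + r"
  let ?S = "{k. k \<le> m \<and> \<rho> / 2 ^ k \<le> ?R}"
  have R: "0 < ?R" using assms by (simp add: add_nonneg_pos)
  have fin: "finite ?S" by simp
  have "mean_on (ball y r) (\<lambda>z. \<Sum>k\<in>?S. indicat_real (ball x (\<rho> / 2 ^ k)) z)
      = (\<Sum>k\<in>?S. measure lebesgue (ball y r \<inter> ball x (\<rho> / 2 ^ k)) / measure lebesgue (ball y r))"
    by (rule mean_on_sum_indicator_balls) auto
  also have "\<dots> \<le> (\<Sum>k\<in>?S. 3 ^ CARD('n) / ?R * (\<rho> / 2 ^ k))"
  proof (rule sum_mono)
    fix k assume "k \<in> ?S"
    then show "measure lebesgue (ball y r \<inter> ball x (\<rho> / 2 ^ k)) / measure lebesgue (ball y r)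
        \<le> 3 ^ CARD('n) / ?R * (\<rho> / 2 ^ k)"
      using measure_ball_inter_le[of "\<rho> / 2 ^ k" r x y] assms measure_ball_pos[of r y]
      by (simp add: divide_le_eq mult_ac)
  qed
  also have "\<dots> = 3 ^ CARD('n) / ?R * (\<Sum>k\<in>?S. \<rho> / 2 ^ k)"
    by (simp only: sum_distrib_left)
  also have "\<dots> \<le> 3 ^ CARD('n) / ?R * (2 * ?R)"
    using R assms by (intro mult_left_mono sum_dyadic_below_le) auto
  also have "\<dots> = 2 * 3 ^ CARD('n)"
    using R by (simp add: field_simps)
  finally show ?thesis .
qed

lemma locally_integrable_dyadic_staircase:
  fixes x :: "real ^ 'n"
  shows "locally_integrable (\<lambda>z. of_real (dyadic_staircase x \<rho> m z)
    :: 'b::{real_normed_field,banach,second_countable_topology})"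
  unfolding locally_integrable_def
proof (intro allI impI)
  fix K :: "(real ^ 'n) set" assume "compact K"
  then have "set_integrable lebesgue K (dyadic_staircase x \<rho> m)"
    unfolding dyadic_staircase_def
    by (intro set_integrable_sum_indicator_balls lmeasurable_compact) auto
  then have "integrable lebesgue (\<lambda>z. of_real (indicator K z * dyadic_staircase x \<rho> m z) :: 'b)"
    unfolding set_integrable_def by (intro integrable_of_real) simp
  then show "set_integrable lebesgue K (\<lambda>z. of_real (dyadic_staircase x \<rho> m z) :: 'b)"
    by (simp add: set_integrable_def scaleR_conv_of_real)
qed

lemma dyadic_staircase_eq:
  assumes "\<rho> / 2 ^ m \<ge> s" "0 < \<rho>" "z \<in> ball x s"
  shows "dyadic_staircase x \<rho> m z = real (Suc m)"
proof -
  have "z \<in> ball x (\<rho> / 2 ^ k)" if "k \<le> m" for k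
  proof -
    have "\<rho> / 2 ^ m \<le> \<rho> / 2 ^ k"
      using that assms(2) by (intro divide_left_mono power_increasing) auto
    then show ?thesis using assms by auto
  qed
  then show ?thesis
    by (simp add: dyadic_staircase_def)
qed

text \<open>Over \<open>ball y r\<close> the steps of radius above \<open>dist x y + r\<close> are constant and do not contribute to
  the oscillation; the others have mean at most \<open>2 * 3\<^sup>n\<close>. If \<open>r\<close> is at least the critical radius
  at \<open>y\<close>, then \<open>critical_radius_le_add_dist\<close> shows that every step is of the second kind, which
  bounds the mean itself.\<close>

lemma BMO_H_bound_dyadic_staircase:
  fixes x :: "real ^ 'n"
  defines "\<rho> \<equiv> critical_radius x"
  shows "BMO_H_bound (\<lambda>z. of_real (dyadic_staircase x \<rho> m z)
    :: 'b::{real_normed_field,banach,second_countable_topology}) (4 * 3 ^ CARD('n))"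
    (is "BMO_H_bound ?f _")
  unfolding BMO_H_bound_def
proof (intro conjI allI impI)
  have \<rho>: "0 < \<rho>" by (simp add: \<rho>_def critical_radius_pos)
  fix y :: "real ^ 'n" and r :: real
  let ?S = "{k. k \<le> m \<and> \<rho> / 2 ^ k \<le> dist x y + r}"
  {
    assume r: "0 < r"
    let ?L = "{k. k \<le> m \<and> \<not> \<rho> / 2 ^ k \<le> dist x y + r}"
    have "norm (?f z - of_real (card ?L)) = (\<Sum>k\<in>?S. indicat_real (ball x (\<rho> / 2 ^ k)) z)"
      if z: "z \<in> ball y r" for z
    proof -
      have split: "{..m} = ?S \<union> ?L" by auto
      have "z \<in> ball x (\<rho> / 2 ^ k)" if "k \<in> ?L" for k
        using that z dist_triangle[of x z y] by (auto simp: not_le)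
      then have "(\<Sum>k\<in>?L. indicat_real (ball x (\<rho> / 2 ^ k)) z) = real (card ?L)"
        by simp
      moreover have "dyadic_staircase x \<rho> m z = (\<Sum>k\<in>?S. indicat_real (ball x (\<rho> / 2 ^ k)) z)
          + (\<Sum>k\<in>?L. indicat_real (ball x (\<rho> / 2 ^ k)) z)"
        unfolding dyadic_staircase_def split by (intro sum.union_disjoint) auto
      ultimately have "dyadic_staircase x \<rho> m z - real (card ?L)
          = (\<Sum>k\<in>?S. indicat_real (ball x (\<rho> / 2 ^ k)) z)" by simp
      then show ?thesis
        unfolding of_real_diff[symmetric] norm_of_real by (simp add: sum_nonneg)
    qed
    then have "mean_on (ball y r) (\<lambda>z. norm (?f z - of_real (card ?L)))
        = mean_on (ball y r) (\<lambda>z. \<Sum>k\<in>?S. indicat_real (ball x (\<rho> / 2 ^ k)) z)"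
      by (intro mean_on_cong) auto
    then have "mean_on (ball y r) (\<lambda>z. norm (?f z - of_real (card ?L))) \<le> 2 * 3 ^ CARD('n)"
      using mean_on_small_balls_le[OF \<rho> r] by (rule ord_eq_le_trans)
    moreover have "mean_oscillation (ball y r) ?f
        \<le> 2 * mean_on (ball y r) (\<lambda>z. norm (?f z - of_real (card ?L)))"
      using r by (intro mean_oscillation_le locally_integrable_ball
          locally_integrable_dyadic_staircase) auto
    ultimately show "mean_oscillation (ball y r) ?f \<le> 4 * 3 ^ CARD('n)"
      by linarith
  next
    assume "critical_radius y \<le> r"
    then have r: "0 < r" and R: "\<rho> \<le> dist x y + r"
      using critical_radius_pos[of y] critical_radius_le_add_dist[of x y] by (auto simp: \<rho>_def)
    have "\<rho> / 2 ^ k \<le> \<rho>" for k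
      using \<rho> by (simp add: divide_le_eq)
    then have "\<rho> / 2 ^ k \<le> dist x y + r" for k
      using R by (rule order_trans)
    then have "?S = {..m}"
      by auto
    then have "mean_on (ball y r) (\<lambda>z. norm (?f z))
        = mean_on (ball y r) (\<lambda>z. \<Sum>k\<in>?S. indicat_real (ball x (\<rho> / 2 ^ k)) z)"
      unfolding norm_of_real by (intro mean_on_cong) (auto simp: dyadic_staircase_def sum_nonneg)
    also have "\<dots> \<le> 2 * 3 ^ CARD('n)"
      by (rule mean_on_small_balls_le[OF \<rho> r])
    also have "\<dots> \<le> 4 * 3 ^ CARD('n)" by simp
    finally show "mean_on (ball y r) (\<lambda>z. norm (?f z)) \<le> 4 * 3 ^ CARD('n)" .
  }
qed

section \<open>Multipliers are bounded and have logarithmically small oscillation\<close>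

text \<open>Lebesgue differentiation of \<open>\<bar>g\<bar>\<close> along cubes with corner \<open>x\<close>. The cube of side \<open>s / (2 n)\<close>
  lies in \<open>ball x s\<close> because its diameter is at most \<open>n\<close> times its side; passing from the ball to the cube
  costs the ratio of their volumes, which is the constant next to \<open>M\<close>.\<close>

lemma AE_norm_le_if_ball_means_le:
  fixes g :: "real ^ 'n \<Rightarrow> 'b::{real_normed_field,banach,second_countable_topology}"
  assumes g: "locally_integrable g"
    and small: "\<And>x e. 0 < e \<Longrightarrow> \<exists>s. 0 < s \<and> s < e \<and> mean_on (ball x s) (\<lambda>y. norm (g y)) \<le> M"
  shows "AE x in lebesgue. norm (g x)
    \<le> M * (unit_ball_vol (real CARD('n)) * (2 * real CARD('n)) ^ CARD('n))"
proof -
  let ?n = "CARD('n)" and ?V = "unit_ball_vol (real CARD('n))"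
  let ?L = "M * (?V * (2 * real ?n) ^ ?n)"
  let ?h = "\<lambda>y. norm (g y)"
  let ?cube = "\<lambda>x h. cbox x (x + h *\<^sub>R One) :: (real ^ 'n) set"
  have abs: "set_integrable lebesgue (cbox a b) ?h" for a b
    using g by (intro set_integrable_norm) (auto simp: locally_integrable_def)
  have cube_le: "integral (?cube x (s / (2 * ?n))) ?h /\<^sub>R (s / (2 * ?n)) ^ DIM(real ^ 'n) \<le> ?L"
    if s: "0 < s" and mean: "mean_on (ball x s) ?h \<le> M" for x s
  proof -
    let ?t = "s / (2 * ?n)"
    have t: "0 < ?t" using s by simp
    have sub: "?cube x ?t \<subseteq> ball x s"
    proof
      fix z assume z: "z \<in> ?cube x ?t"
      have "\<bar>(z - x) \<bullet> b\<bar> \<le> ?t" if "b \<in> Basis" for b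
        using z that by (auto simp: mem_box inner_diff_left inner_add_left inner_sum_left_Basis)
      then have "(\<Sum>b\<in>Basis. \<bar>(z - x) \<bullet> b\<bar>) \<le> (\<Sum>b\<in>(Basis :: (real ^ 'n) set). ?t)"
        by (intro sum_mono)
      also have "\<dots> = s / 2" by simp
      finally have "norm (z - x) \<le> s / 2"
        using norm_le_l1[of "z - x"] by linarith
      then show "z \<in> ball x s"
        using s by (simp add: dist_norm norm_minus_commute)
    qed
    have "integral (?cube x ?t) ?h = (LINT y:?cube x ?t|lebesgue. ?h y)"
      using set_lebesgue_integral_eq_integral(2)[OF abs] by simp
    also have "\<dots> \<le> (LINT y:ball x s|lebesgue. ?h y)"
      unfolding set_lebesgue_integral_def
    proof (rule integral_mono)
      show "indicator (?cube x ?t) y *\<^sub>R ?h y \<le> indicator (ball x s) y *\<^sub>R ?h y" for y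
        using subsetD[OF sub, of y] by (cases "y \<in> ?cube x ?t"; cases "y \<in> ball x s") simp_all
    qed (use abs set_integrable_norm[OF locally_integrable_ball[OF g, of x s]] in
        \<open>simp_all only: set_integrable_def\<close>)
    also have "\<dots> \<le> M * measure lebesgue (ball x s)"
      using mean measure_ball_pos[OF s, of x] by (simp add: mean_on_def divide_le_eq)
    also have "\<dots> = ?L * ?t ^ ?n"
      using measure_ball[of s x] s by (simp add: power_divide power_mult_distrib)
    finally show ?thesis
      using t by (simp add: field_simps)
  qed
  obtain N where N: "negligible N" and
    lim: "\<And>x e. x \<notin> N \<Longrightarrow> 0 < e \<Longrightarrow> \<exists>d>0. \<forall>h. 0 < h \<and> h < d \<longrightarrow>
      norm (integral (?cube x h) ?h /\<^sub>R h ^ DIM(real ^ 'n) - ?h x) < e"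
    by (fact integrable_ccontinuous_explicit[OF set_lebesgue_integral_eq_integral(1)[OF abs]])
  have "?h x \<le> ?L" if x: "x \<notin> N" for x
  proof (rule field_le_epsilon)
    fix e :: real assume "0 < e"
    from lim[OF x this] obtain d where d: "0 < d" and
      close: "\<forall>h. 0 < h \<and> h < d \<longrightarrow>
        norm (integral (?cube x h) ?h /\<^sub>R h ^ DIM(real ^ 'n) - ?h x) < e"
      by (elim exE conjE)
    obtain s where s: "0 < s" "s < 2 * ?n * d" "mean_on (ball x s) ?h \<le> M"
      using small[of "2 * ?n * d" x] d by auto
    have "s / (2 * ?n) < d" "0 < s / (2 * ?n)"
      using s by (simp_all add: divide_less_eq mult_ac)
    then show "?h x \<le> ?L + e"
      using cube_le[OF s(1,3)] close[rule_format, of "s / (2 * ?n)"] unfolding real_norm_def by linarith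
  qed
  then have "{x. \<not> ?h x \<le> ?L} \<subseteq> N" by blast
  then show ?thesis
    using N by (intro AE_I'[of N]) (auto simp: negligible_iff_null_sets)
qed

text \<open>Applied to this function, a multiplier operator returns its symbol, which is therefore locally
  integrable.\<close>

lemma one_in_BMO_H:
  "(\<lambda>_. 1) \<in> (BMO_H :: (real ^ 'n \<Rightarrow> 'b::{real_normed_field,banach,second_countable_topology}) set)"
proof (rule BMO_H_I)
  show "locally_integrable (\<lambda>_ :: real ^ 'n. 1 :: 'b)"
    by (simp add: locally_integrable_def set_integrable_const_lmeasurable lmeasurable_compact)
  have mean: "mean_on (ball x r) (\<lambda>_. c) = c" if "0 < r"
    for x :: "real ^ 'n" and r and c :: "'c::{banach,second_countable_topology}"
    using that by (intro mean_on_const) auto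
  have "0 < r" if "critical_radius x \<le> r" for x :: "real ^ 'n" and r
    using critical_radius_pos[of x] that by linarith
  then show "BMO_H_bound (\<lambda>_ :: real ^ 'n. 1 :: 'b) 1"
    by (simp add: BMO_H_bound_def mean_oscillation_def mean)
qed

lemma multiplier_necessary:
  fixes g :: "real ^ 'n \<Rightarrow> 'b::{real_normed_field,banach,second_countable_topology}"
  assumes meas: "g \<in> borel_measurable lebesgue"
    and bdd: "bounded_operator_in_BMO_H (multiplier_op g)"
  shows "g \<in> L_infinity"
    and "\<exists>C>0. \<forall>x s. 0 < s \<and> s \<le> critical_radius x \<longrightarrow>
        ln (critical_radius x / s) * mean_oscillation (ball x s) g \<le> C"
proof -
  obtain A where A: "\<And>f. f \<in> BMO_H \<Longrightarrow> (\<lambda>x. f x * g x) \<in> BMO_H"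
    "\<And>f. f \<in> BMO_H \<Longrightarrow> BMO_H_norm (\<lambda>x. f x * g x) \<le> A * BMO_H_norm f"
    using bdd by (auto simp: bounded_operator_in_BMO_H_def multiplier_op_def)
  have g: "locally_integrable g"
    using A(1)[OF one_in_BMO_H] by (simp add: BMO_H_def)
  define K where "K = \<bar>A\<bar> * (4 * 3 ^ CARD('n))"
  define F where "F x m = (\<lambda>z. of_real (dyadic_staircase x (critical_radius x) m z) :: 'b)"
    for x :: "real ^ 'n" and m
  have F: "F x m \<in> BMO_H" "BMO_H_norm (F x m) \<le> 4 * 3 ^ CARD('n)" for x m
    unfolding F_def
    using BMO_H_I[OF locally_integrable_dyadic_staircase BMO_H_bound_dyadic_staircase]
      BMO_H_norm_le[OF BMO_H_bound_dyadic_staircase] by auto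
  have Fg: "locally_integrable (\<lambda>z. F x m z * g z)" "BMO_H_bound (\<lambda>z. F x m z * g z) K" for x m
  proof -
    show "locally_integrable (\<lambda>z. F x m z * g z)"
      using A(1)[OF F(1)] by (simp add: BMO_H_def)
    have "A * BMO_H_norm (F x m) \<le> \<bar>A\<bar> * BMO_H_norm (F x m)"
      using BMO_H_bound_nonneg[OF BMO_H_bound_norm[OF F(1)]] by (intro mult_right_mono) auto
    also have "\<dots> \<le> K"
      unfolding K_def by (intro mult_left_mono F(2)) auto
    finally show "BMO_H_bound (\<lambda>z. F x m z * g z) K"
      using A(2)[OF F(1)] BMO_H_bound_norm[OF A(1)[OF F(1)]] BMO_H_bound_mono order_trans by blast
  qed
  have const: "F x m z * g z = of_nat (Suc m) * g z"
    if "s \<le> critical_radius x / 2 ^ m" "z \<in> ball x s" for x m s z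
    using dyadic_staircase_eq[OF that(1) critical_radius_pos that(2)] unfolding F_def by simp
  \<comment> \<open>On a ball inside the top step, multiplication by the test function is multiplication by a number.\<close>
  have osc: "real (Suc m) * mean_oscillation (ball x s) g \<le> K"
    if s: "0 < s" "s \<le> critical_radius x / 2 ^ m" for x s m
  proof -
    have "real (Suc m) * mean_oscillation (ball x s) g
        = mean_oscillation (ball x s) (\<lambda>z. of_nat (Suc m) * g z)"
      by (simp add: mean_oscillation_mult_left del: of_nat_Suc)
    also have "\<dots> = mean_oscillation (ball x s) (\<lambda>z. F x m z * g z)"
      by (intro mean_oscillation_cong const[OF s(2), symmetric]) auto
    also have "\<dots> \<le> K"
      using Fg(2) s(1) by (auto simp: BMO_H_bound_def)
    finally show ?thesis .
  qed

  have K0: "0 \<le> K" by (simp add: K_def)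
  show "\<exists>C>0. \<forall>x s. 0 < s \<and> s \<le> critical_radius x \<longrightarrow>
      ln (critical_radius x / s) * mean_oscillation (ball x s) g \<le> C"
  proof (intro exI[of _ "K + 1"] conjI allI impI)
    fix x :: "real ^ 'n" and s assume s: "0 < s \<and> s \<le> critical_radius x"
    define q where "q = critical_radius x / s"
    have q: "1 \<le> q" using s by (simp add: q_def)
    \<comment> \<open>The number of halvings of the critical radius that keep it at least \<open>s\<close>.\<close>
    define m where "m = nat \<lfloor>log 2 q\<rfloor>"
    have log0: "0 \<le> log 2 q" using q by simp
    then have m: "real m \<le> log 2 q" "log 2 q < real m + 1"
      unfolding m_def by (auto simp: of_nat_nat)
    have "2 ^ m \<le> q"
      using m(1) q by (simp add: le_log_iff powr_realpow)
    then have "s \<le> critical_radius x / 2 ^ m"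
      using s by (simp add: q_def field_simps)
    then have "real (Suc m) * mean_oscillation (ball x s) g \<le> K"
      using osc s by blast
    moreover have "ln q \<le> real (Suc m)"
    proof -
      have "ln q = ln 2 * log 2 q" by (simp add: log_def)
      also have "\<dots> \<le> 1 * log 2 q"
        using log0 ln_2_less_1 by (intro mult_right_mono) auto
      finally show ?thesis using m(2) by simp
    qed
    then have "ln q * mean_oscillation (ball x s) g \<le> real (Suc m) * mean_oscillation (ball x s) g"
      by (intro mult_right_mono mean_oscillation_nonneg)
    ultimately show "ln (critical_radius x / s) * mean_oscillation (ball x s) g \<le> K + 1"
      by (simp add: q_def)
  qed (use K0 in simp)

  \<comment> \<open>The logarithmic growth of the mean is absorbed by the height \<open>m + 1\<close> of the test function.\<close>
  have "mean_on (ball x (critical_radius x / 2 ^ m)) (\<lambda>y. norm (g y)) \<le> K * (2 + 2 ^ CARD('n))"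
    for x m
  proof -
    define s where "s = critical_radius x / 2 ^ m"
    have s: "0 < s" by (simp add: s_def critical_radius_pos)
    let ?B = "ball x s" and ?f = "\<lambda>z. F x m z * g z"
    have "real (Suc m) * mean_on ?B (\<lambda>y. norm (g y)) = mean_on ?B (\<lambda>y. real (Suc m) * norm (g y))"
      by (rule mean_on_mult_left[symmetric])
    also have "\<dots> = mean_on ?B (\<lambda>y. norm (?f y))"
      by (intro mean_on_cong) (auto simp: const[of s x m] s_def norm_mult simp del: of_nat_Suc)
    also have "\<dots> \<le> mean_oscillation ?B ?f + norm (mean_on ?B ?f)"
      using s by (intro mean_norm_le_oscillation locally_integrable_ball Fg(1)) auto
    also have "\<dots> \<le> K + K * (1 + real m * 2 ^ CARD('n))"
      using Fg(2)[of x m] s by (intro add_mono norm_mean_on_ball_le Fg)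
        (auto simp: BMO_H_bound_def s_def)
    also have "\<dots> = K * (2 + real m * 2 ^ CARD('n))"
      by (simp add: algebra_simps)
    also have "\<dots> \<le> K * (real (Suc m) * (2 + 2 ^ CARD('n)))"
      using K0 by (intro mult_left_mono) (auto simp: algebra_simps)
    finally have "real (Suc m) * mean_on ?B (\<lambda>y. norm (g y))
        \<le> real (Suc m) * (K * (2 + 2 ^ CARD('n)))"
      by (simp only: mult_ac)
    then show ?thesis
      unfolding s_def by (subst (asm) mult_le_cancel_left_pos) auto
  qed
  moreover have "\<exists>m. critical_radius x / 2 ^ m < e" if "0 < e" for x :: "real ^ 'n" and e
    using real_arch_pow[of 2 "critical_radius x / e"] that by (auto simp: field_simps)
  ultimately have "\<exists>s>0. s < e \<and> mean_on (ball x s) (\<lambda>y. norm (g y)) \<le> K * (2 + 2 ^ CARD('n))"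
    if "0 < e" for x e
    using that critical_radius_pos[of x] by (metis divide_pos_pos zero_less_numeral zero_less_power)
  then show "g \<in> L_infinity"
    using AE_norm_le_if_ball_means_le[OF g] meas unfolding L_infinity_def by blast
qed

section \<open>Bounded functions of logarithmically small oscillation are multipliers\<close>

lemma set_integrable_mult_bounded:
  fixes f g :: "real ^ 'n \<Rightarrow> 'b::{real_normed_field,banach,second_countable_topology}"
  assumes "g \<in> borel_measurable lebesgue" "AE x in lebesgue. norm (g x) \<le> M"
    and "set_integrable lebesgue B f"
  shows "set_integrable lebesgue B (\<lambda>y. f y * g y)"
proof -
  have int: "integrable lebesgue (\<lambda>y. indicat_real B y *\<^sub>R f y)"
    using assms(3) by (simp add: set_integrable_def)
  have "integrable lebesgue (\<lambda>y. (indicat_real B y *\<^sub>R f y) * g y)"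
  proof (rule Bochner_Integration.integrable_bound)
    show "integrable lebesgue (\<lambda>y. M *\<^sub>R (indicat_real B y *\<^sub>R f y))"
      using int by (rule integrable_scaleR_right)
    show "(\<lambda>y. (indicat_real B y *\<^sub>R f y) * g y) \<in> borel_measurable lebesgue"
      using assms(1) int by (intro borel_measurable_times) auto
    show "AE y in lebesgue. norm ((indicat_real B y *\<^sub>R f y) * g y)
        \<le> norm (M *\<^sub>R (indicat_real B y *\<^sub>R f y))"
      using assms(2)
    proof eventually_elim
      case (elim y)
      define v where "v = indicat_real B y *\<^sub>R f y"
      have "norm v * norm (g y) \<le> norm v * \<bar>M\<bar>"
        using elim by (intro mult_left_mono) auto
      then show ?case
        unfolding v_def[symmetric] by (simp add: norm_mult mult.commute)
    qed
  qed
  then show ?thesis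
    by (simp add: set_integrable_def)
qed

text \<open>The constant does not depend on \<open>f\<close>. Its last two terms come from the product of the mean of \<open>f\<close>
  with the oscillation of \<open>g\<close>, after the number of doublings in the growth estimate has been
  converted into a natural logarithm; rounding that number up costs one more oscillation of \<open>g\<close>,
  which is at most \<open>2 * M\<close>.\<close>

lemma BMO_H_bound_mult:
  fixes f g :: "real ^ 'n \<Rightarrow> 'b::{real_normed_field,banach,second_countable_topology}"
  assumes f: "locally_integrable f" "BMO_H_bound f C"
    and g: "g \<in> borel_measurable lebesgue" "AE x in lebesgue. norm (g x) \<le> M" "0 \<le> M"
    and osc_g: "\<And>x s. 0 < s \<Longrightarrow> s \<le> critical_radius x \<Longrightarrow>
        ln (critical_radius x / s) * mean_oscillation (ball x s) g \<le> D"
  shows "BMO_H_bound (\<lambda>x. f x * g x)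
    (2 * (M + (1 + 2 ^ CARD('n)) * (2 * M) + 2 ^ CARD('n) * D / ln 2) * C)"
    (is "BMO_H_bound ?fg (2 * ?A * C)")
  unfolding BMO_H_bound_def
proof (intro conjI allI impI)
  fix x :: "real ^ 'n" and r :: real
  let ?B = "ball x r"
  have C0: "0 \<le> C" by (rule BMO_H_bound_nonneg[OF f(2)])
  have D0: "0 \<le> D" using osc_g[of "critical_radius x" x] critical_radius_pos[of x] by simp
  have MA: "M * C \<le> ?A * C"
    using C0 D0 g(3) by (intro mult_right_mono) auto
  have fint: "set_integrable lebesgue ?B f" by (rule locally_integrable_ball[OF f(1)])
  have fgint: "set_integrable lebesgue ?B ?fg"
    by (rule set_integrable_mult_bounded[OF g(1,2) fint])
  have const: "set_integrable lebesgue ?B (\<lambda>_. c)" for c :: "'c::{banach,second_countable_topology}"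
    by (rule set_integrable_const_lmeasurable) simp
  have large: "mean_on ?B (\<lambda>y. norm (?fg y)) \<le> M * C" if "critical_radius x \<le> r"
  proof -
    have "mean_on ?B (\<lambda>y. norm (?fg y)) \<le> mean_on ?B (\<lambda>y. M * norm (f y))"
    proof (rule mean_on_mono_AE)
      show "AE y in lebesgue. norm (?fg y) \<le> M * norm (f y)"
        using g(2) by eventually_elim (metis mult.commute mult_left_mono norm_ge_zero norm_mult)
    qed (use fgint fint in \<open>auto intro: set_integrable_norm\<close>)
    also have "\<dots> = M * mean_on ?B (\<lambda>y. norm (f y))"
      by (rule mean_on_mult_left)
    also have "\<dots> \<le> M * C"
      using f(2) g(3) that by (intro mult_left_mono) (auto simp: BMO_H_bound_def)
    finally show ?thesis .
  qed
  {
    assume r: "0 < r"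
    have B: "?B \<in> lmeasurable" "0 < measure lebesgue ?B" using r by auto
    show "mean_oscillation ?B ?fg \<le> 2 * ?A * C"
    proof (cases "critical_radius x \<le> r")
      case True
      have "mean_oscillation ?B ?fg \<le> 2 * mean_on ?B (\<lambda>y. norm (?fg y))"
        using mean_oscillation_le[OF B fgint, of 0] by simp
      then show ?thesis
        using large[OF True] MA by linarith
    next
      case False
      let ?c = "mean_on ?B f" and ?d = "mean_on ?B g"
      have gint: "set_integrable lebesgue ?B g"
        using set_integrable_mult_bounded[OF g(1,2) const[of 1]] by simp
      note fdiff = set_integrable_norm_diff_const[OF B(1) fint, of ?c]
      note gdiff = set_integrable_norm_diff_const[OF B(1) gint, of ?d]
      have "mean_on ?B (\<lambda>y. norm (?fg y - ?c * ?d))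
          \<le> mean_on ?B (\<lambda>y. M * norm (f y - ?c) + norm ?c * norm (g y - ?d))"
      proof (rule mean_on_mono_AE)
        show "AE y in lebesgue. norm (?fg y - ?c * ?d) \<le> M * norm (f y - ?c) + norm ?c * norm (g y - ?d)"
          using g(2)
        proof eventually_elim
          case (elim y)
          have "?fg y - ?c * ?d = (f y - ?c) * g y + ?c * (g y - ?d)"
            by (simp add: algebra_simps)
          then have "norm (?fg y - ?c * ?d) \<le> norm (f y - ?c) * norm (g y) + norm ?c * norm (g y - ?d)"
            by (metis norm_mult norm_triangle_ineq)
          moreover have "norm (f y - ?c) * norm (g y) \<le> norm (f y - ?c) * M"
            using elim by (intro mult_left_mono) auto
          ultimately show ?case by (simp add: mult.commute)
        qed
      qed (use fdiff gdiff set_integrable_norm_diff_const[OF B(1) fgint] in auto)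
      also have "\<dots> = M * mean_oscillation ?B f + norm ?c * mean_oscillation ?B g"
        using fdiff gdiff by (simp add: mean_on_add mean_on_mult_left mean_oscillation_def)
      finally have split: "mean_on ?B (\<lambda>y. norm (?fg y - ?c * ?d))
          \<le> M * mean_oscillation ?B f + norm ?c * mean_oscillation ?B g" .
      define q where "q = critical_radius x / r"
      have q: "1 \<le> q" using False r by (simp add: q_def)
      \<comment> \<open>The number of doublings of \<open>r\<close> that reach the critical radius.\<close>
      define m where "m = nat \<lceil>log 2 q\<rceil>"
      have "0 \<le> log 2 q" using q by simp
      then have m: "log 2 q \<le> real m" "real m \<le> log 2 q + 1"
        unfolding m_def by linarith+
      have "q \<le> 2 ^ m"
        using m(1) q by (simp add: log_le_iff powr_realpow)
      then have "critical_radius x \<le> 2 ^ m * r"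
        using r by (simp add: q_def divide_le_eq)
      then have c: "norm ?c \<le> C * (1 + real m * 2 ^ CARD('n))"
        by (rule norm_mean_on_ball_le[OF f r])
      let ?o = "mean_oscillation ?B g"
      have o: "0 \<le> ?o" "?o \<le> 2 * M"
      proof -
        show "0 \<le> ?o" by (rule mean_oscillation_nonneg)
        have "mean_on ?B (\<lambda>y. norm (g y)) \<le> mean_on ?B (\<lambda>_. M)"
          using set_integrable_norm[OF gint] const g(2) by (rule mean_on_mono_AE)
        then show "?o \<le> 2 * M"
          using mean_oscillation_le[OF B gint, of 0] by (simp add: mean_on_const[OF B])
      qed
      have "ln q * ?o \<le> D"
        unfolding q_def using False r by (intro osc_g) auto
      then have "log 2 q * ?o \<le> D / ln 2"
        by (simp add: log_def divide_right_mono)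
      moreover have "real m * ?o \<le> (log 2 q + 1) * ?o"
        using m(2) o(1) by (rule mult_right_mono)
      ultimately have mo: "real m * ?o \<le> D / ln 2 + 2 * M"
        using o(2) by (simp add: algebra_simps)
      have "norm ?c * ?o \<le> C * (1 + real m * 2 ^ CARD('n)) * ?o"
        using c o(1) by (rule mult_right_mono)
      also have "\<dots> = C * (?o + 2 ^ CARD('n) * (real m * ?o))"
        by (simp add: algebra_simps)
      also have "\<dots> \<le> C * (2 * M + 2 ^ CARD('n) * (D / ln 2 + 2 * M))"
        using C0 o(2) mo by (intro mult_left_mono add_mono) auto
      finally have "norm ?c * ?o \<le> C * (2 * M + 2 ^ CARD('n) * (D / ln 2 + 2 * M))" .
      moreover have "M * mean_oscillation ?B f \<le> M * C"
        using f(2) r g(3) by (intro mult_left_mono) (auto simp: BMO_H_bound_def)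
      ultimately have "mean_on ?B (\<lambda>y. norm (?fg y - ?c * ?d)) \<le> ?A * C"
        using split by (simp add: algebra_simps)
      then show ?thesis
        using mean_oscillation_le[OF B fgint, of "?c * ?d"] by linarith
    qed
  next
    assume "critical_radius x \<le> r"
    moreover have "0 \<le> ?A * C"
      using C0 g(3) MA by (meson mult_nonneg_nonneg order_trans)
    then have "1 * (?A * C) \<le> 2 * (?A * C)"
      by (intro mult_right_mono) auto
    then have "?A * C \<le> 2 * ?A * C"
      by (simp only: mult.assoc mult_1_left)
    ultimately show "mean_on ?B (\<lambda>y. norm (?fg y)) \<le> 2 * ?A * C"
      using large MA by linarith
  }
qed

lemma multiplier_sufficient:
  fixes g :: "real ^ 'n \<Rightarrow> 'b::{real_normed_field,banach,second_countable_topology}"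
  assumes "g \<in> L_infinity"
    and osc_g: "\<And>x s. 0 < s \<Longrightarrow> s \<le> critical_radius x \<Longrightarrow>
        ln (critical_radius x / s) * mean_oscillation (ball x s) g \<le> D"
  shows "bounded_operator_in_BMO_H (multiplier_op g)"
proof -
  obtain M' where g: "g \<in> borel_measurable lebesgue" and M': "AE x in lebesgue. norm (g x) \<le> M'"
    using assms(1) by (auto simp: L_infinity_def)
  define M where "M = \<bar>M'\<bar>"
  have M: "AE x in lebesgue. norm (g x) \<le> M" "0 \<le> M"
    using M' by (auto simp: M_def)
  let ?A = "2 * (M + (1 + 2 ^ CARD('n)) * (2 * M) + 2 ^ CARD('n) * D / ln 2)"
  have "(\<lambda>x. f x * g x) \<in> BMO_H \<and> BMO_H_norm (\<lambda>x. f x * g x) \<le> ?A * BMO_H_norm f"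
    if f: "f \<in> BMO_H" for f
  proof -
    have loc: "locally_integrable f" using f by (simp add: BMO_H_def)
    have "BMO_H_bound (\<lambda>x. f x * g x) (?A * BMO_H_norm f)"
      by (rule BMO_H_bound_mult[OF loc BMO_H_bound_norm[OF f] g M osc_g])
    moreover have "locally_integrable (\<lambda>x. f x * g x)"
      using loc set_integrable_mult_bounded[OF g M(1)] by (simp add: locally_integrable_def)
    ultimately show ?thesis
      using BMO_H_I BMO_H_norm_le by blast
  qed
  then show ?thesis
    unfolding bounded_operator_in_BMO_H_def multiplier_op_def by blast
qed

theorem proposition3p1:
  fixes g :: "real ^ 'n \<Rightarrow> 'b::{real_normed_field,banach,second_countable_topology}"
  assumes "g \<in> borel_measurable lebesgue"
  shows "bounded_operator_in_BMO_H (multiplier_op g) \<longleftrightarrow>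
     g \<in> L_infinity \<and>
     (\<exists>C>0. \<forall>x s. 0 < s \<and> s \<le> critical_radius x \<longrightarrow>
        ln (critical_radius x / s) * mean_oscillation (ball x s) g \<le> C)"
  using multiplier_necessary[OF assms] multiplier_sufficient[of g] by blast

end
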